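(* Let $r\in(0,1]$, $\gamma\in(0,1]$, $\lambda>0$. Then the distribution function $$F(x;r,\gamma,\lambda)=\left(\frac{\lambda x^{\gamma}}{1+\lambda x^{\gamma}}\right)^r,\quad x\ge0,\qquad F(x;r,\gamma,\lambda)=0,\quad x<0,$$ is infinitely divisible.
   Context: A distribution function is infinitely divisible if for every $n\in\mathbb{N}$ the corresponding probability distribution on $\mathbb{R}$ is the $n$-fold convolution of some probability distribution on $\mathbb{R}$ with itself. *)

theory Defs
  imports "HOL-Probability.Probability"
begin

primrec convolution_power :: "real measure \<Rightarrow> nat \<Rightarrow> real measure" where
  "convolution_power N 0 = return borel 0"
| "convolution_power N (Suc n) = (N \<star> convolution_power N n)"

lemma convolution_power_1:
  assumes "real_distribution N"
  shows "convolution_power N 1 = N"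
proof -
  interpret real_distribution N by fact
  have fin: "finite_measure (return borel (0::real))"
    by (intro prob_space.finite_measure prob_space_return) simp
  show ?thesis
  proof (rule measure_eqI)
    fix A assume "A \<in> sets (convolution_power N 1)"
    then have A [measurable]: "A \<in> sets borel" by simp
    have "emeasure (N \<star> return borel 0) A = (\<integral>\<^sup>+x. (\<integral>\<^sup>+y. indicator A (x + y) \<partial>return borel 0) \<partial>N)"
      using fin by (intro convolution_emeasure') (auto intro: finite_measure_axioms)
    also have "\<dots> = (\<integral>\<^sup>+x. indicator A x \<partial>N)"
      by (intro nn_integral_cong) (simp add: nn_integral_return)
    finally show "emeasure (convolution_power N 1) A = emeasure N A"
      by simp
  qed simp
qed

(* The witness M is the distribution corresponding to F; it is unique by cdf_unique.
   Its existence says that F is a distribution function at all. *)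
definition infinitely_divisible_cdf :: "(real \<Rightarrow> real) \<Rightarrow> bool" where
  "infinitely_divisible_cdf F \<longleftrightarrow>
    (\<exists>M. real_distribution M \<and> cdf M = F \<and>
      (\<forall>n\<ge>1. \<exists>N. real_distribution N \<and> M = convolution_power N n))"

end

theory Submission
  imports Defs "HOL-Computational_Algebra.Formal_Power_Series"
begin

text \<open>
  Since \<open>r * \<gamma> \<le> 1\<close> and \<open>x powr \<gamma>\<close> is concave, the density of the distribution is log-convex on
  the positive half-line. By Cauchy's mean value theorem the masses \<open>p k\<close> of the grid cells
  \<open>{k * h<..Suc k * h}\<close> then have increasing ratios \<open>p (Suc k) / p k\<close>. Kaluza's theorem says that
  the generating series \<open>P\<close> of such a sequence satisfies \<open>1 / P = c - V\<close> with \<open>c > 0\<close> and \<open>V\<close> having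
  nonnegative coefficients. Hence \<open>P' / P = V' * P\<close> has nonnegative coefficients, and so does
  \<open>Q = P ^ (1 / n)\<close> because \<open>n * Q' = (P' / P) * Q\<close>. So the discretised distributions have
  convolution roots. These live on the nonnegative half-line, where the tail of a root is
  dominated by the tail of its convolution power; they are therefore tight, and a weak limit as
  \<open>h\<close> tends to 0 is a convolution root of the original distribution.
\<close>

section \<open>Power series with log-convex coefficients and their roots\<close>

unbundle no vec_syntax
unbundle fps_syntax

text \<open>Kaluza's theorem. Subtract \<open>\<rho>\<close> times coefficient \<open>n\<close> of
  \<open>w * p = 1\<close> from coefficient \<open>Suc n\<close>. The terms with
  \<open>i = 0\<close> cancel. For \<open>i > 0\<close> the induction hypothesis
  \<open>w $ i \<le> 0\<close> and the bound of the earlier ratios by \<open>\<rho>\<close> make the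
  differences nonnegative, so \<open>w $ Suc n * p $ 0\<close> must be nonpositive.\<close>

lemma fps_inverse_nonpos_of_log_convex:
  fixes p :: "real fps"
  assumes pos: "\<And>k. p $ k > 0"
    and ratio: "incseq (\<lambda>k. p $ Suc k / p $ k)"
  shows "inverse p $ Suc n \<le> 0"
proof (induction n rule: less_induct)
  case (less n)
  define w where "w = inverse p"
  define \<rho> where "\<rho> = p $ Suc n / p $ n"
  have wp: "w * p = 1"
    unfolding w_def by (rule inverse_mult_eq_1) (use pos[of 0] in simp)
  have coeff: "(\<Sum>i\<le>m. w $ i * p $ (m - i)) = (if m = 0 then 1 else 0)" for m
    using arg_cong[OF wp, of "\<lambda>f. f $ m"] by (simp add: fps_mult_nth atLeast0AtMost)
  have \<rho>: "\<rho> \<ge> 0"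
    using pos[of n] pos[of "Suc n"] by (simp add: \<rho>_def)
  have "0 \<le> \<rho> * (\<Sum>i\<le>n. w $ i * p $ (n - i))"
    using \<rho> by (simp add: coeff)
  also have "\<dots> \<le> (\<Sum>i\<le>n. w $ i * p $ (Suc n - i))"
    unfolding sum_distrib_left
  proof (rule sum_mono)
    fix i assume i: "i \<in> {..n}"
    show "\<rho> * (w $ i * p $ (n - i)) \<le> w $ i * p $ (Suc n - i)"
    proof (cases i)
      case 0
      then show ?thesis using pos[of n] by (simp add: \<rho>_def)
    next
      case (Suc j)
      have "p $ Suc (n - i) / p $ (n - i) \<le> \<rho>"
        unfolding \<rho>_def using incseqD[OF ratio, of "n - i" n] by simp
      then have "p $ (Suc n - i) \<le> \<rho> * p $ (n - i)"
        using i pos[of "n - i"] by (simp add: Suc_diff_le pos_divide_le_eq)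
      moreover have "w $ i \<le> 0"
        using less[of j] i Suc by (simp add: w_def)
      ultimately show ?thesis
        using mult_left_mono_neg[of "p $ (Suc n - i)" "\<rho> * p $ (n - i)" "w $ i"]
        by (simp add: mult_ac)
    qed
  qed
  finally have "w $ Suc n * p $ 0 \<le> 0"
    using coeff[of "Suc n"] by simp
  then show ?case
    using pos[of 0] by (simp add: w_def mult_le_0_iff)
qed

text \<open>Logarithmic differentiation. The series \<open>g\<close> is \<open>p' / p\<close>;
  differentiating \<open>w * p = 1\<close> rewrites it as \<open>- (fps_deriv w) * p\<close>, a
  product of series with nonnegative coefficients. The differential equation \<open>ode\<close> then
  passes nonnegativity from the lower coefficients of \<open>q\<close> to the next one.\<close>

lemma fps_nonneg_root:
  fixes p :: "real fps"
  assumes nonneg: "\<And>k. p $ k \<ge> 0" and p0: "p $ 0 > 0"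
    and inv: "\<And>k. inverse p $ Suc k \<le> 0"
  obtains q where "q ^ Suc n = p" "\<And>k. q $ k \<ge> 0" "q $ 0 > 0"
proof -
  define q where "q = fps_radical (\<lambda>n x. root n x) (Suc n) p"
  define w where "w = inverse p"
  have pow: "q ^ Suc n = p"
    unfolding q_def using p0 by (subst power_radical[symmetric]) (auto simp del: power_Suc)
  have q0: "q $ 0 > 0"
    unfolding q_def using p0 by simp
  have wp: "w * p = 1"
    unfolding w_def by (rule inverse_mult_eq_1) (use p0 in simp)
  define g where "g = w * fps_deriv p"
  have "w * fps_deriv p + fps_deriv w * p = 0"
    using arg_cong[OF wp, of fps_deriv] by (simp add: algebra_simps)
  then have g: "g = - (fps_deriv w) * p"
    unfolding g_def by (simp add: eq_neg_iff_add_eq_0)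
  have g_nonneg: "g $ k \<ge> 0" for k
    unfolding g fps_mult_nth using inv nonneg
    by (intro sum_nonneg mult_nonneg_nonneg) (auto simp: w_def mult_nonneg_nonpos)
  \<comment> \<open>The power rule yields only \<open>q ^ n\<close>. A further factor
    \<open>q\<close> completes it to \<open>q ^ Suc n = p\<close>, which the factor \<open>w\<close>
    then cancels.\<close>
  have "of_nat (Suc n) * fps_deriv q * q ^ n = fps_deriv p"
    using fps_deriv_power[of q "Suc n"] pow
    by (simp add: mult_ac fps_of_nat del: power_Suc of_nat_Suc)
  then have "of_nat (Suc n) * fps_deriv q * q ^ Suc n = fps_deriv p * q"
    by (metis mult.assoc mult.commute power_Suc)
  then have "of_nat (Suc n) * fps_deriv q * (w * p) = g * q"
    unfolding pow g_def by (metis mult.assoc mult.commute)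
  then have ode: "of_nat (Suc n) * fps_deriv q = g * q"
    by (simp add: wp)
  have "q $ k \<ge> 0" for k
  proof (induction k rule: less_induct)
    case (less k)
    show ?case
    proof (cases k)
      case 0
      then show ?thesis using q0 by simp
    next
      case (Suc j)
      \<comment> \<open>The right-hand side involves only \<open>q $ 0\<close> up to
        \<open>q $ j\<close>, which the induction hypothesis covers.\<close>
      have "real (Suc n) * (real (Suc j) * q $ Suc j) = (g * q) $ j"
        using arg_cong[OF ode, of "\<lambda>f. f $ j"]
        by (simp add: fps_of_nat[symmetric] del: of_nat_Suc)
      also have "\<dots> \<ge> 0"
        unfolding fps_mult_nth using less Suc g_nonneg
        by (intro sum_nonneg mult_nonneg_nonneg) auto
      finally show ?thesis
        using Suc by (simp add: zero_le_mult_iff)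
    qed
  qed
  with pow q0 show thesis by (intro that)
qed

text \<open>Absolute summability of the coefficients makes Cauchy products valid on the closed unit
  disc. The boundary is what matters: the series are evaluated at \<open>z = 1\<close> and at
  \<open>z = iexp (t * h)\<close>.\<close>

lemma fps_power_sums:
  fixes q :: "real fps" and z :: complex
  assumes "summable (\<lambda>k. norm (q $ k))" and z: "norm z \<le> 1"
  shows "(\<lambda>k. of_real ((q ^ n) $ k) * z ^ k) sums (\<Sum>k. of_real (q $ k) * z ^ k) ^ n"
proof -
  have abs: "summable (\<lambda>k. norm (of_real (f $ k) * z ^ k))"
    if "summable (\<lambda>k. norm (f $ k))" for f :: "real fps"
    using that
  proof (rule summable_comparison_test'[where N = 0])
    fix k
    show "norm (norm (of_real (f $ k) * z ^ k)) \<le> norm (f $ k)"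
      using z by (simp add: norm_mult norm_power mult_left_le power_le_one)
  qed
  \<comment> \<open>Absolute summability is carried through the induction because the Cauchy product
    requires it of both factors.\<close>
  have *: "summable (\<lambda>k. norm ((q ^ n) $ k)) \<and>
    (\<lambda>k. of_real ((q ^ n) $ k) * z ^ k) sums (\<Sum>k. of_real (q $ k) * z ^ k) ^ n"
  proof (induction n)
    case 0
    have "(\<lambda>k. of_real (1 $ k) * z ^ k) sums (\<Sum>k\<in>{0}. of_real (1 $ k) * z ^ k)"
      by (rule sums_finite) auto
    moreover have "summable (\<lambda>k. norm ((1 :: real fps) $ k))"
      by (rule summable_finite[of "{0}"]) auto
    ultimately show ?case by simp
  next
    case (Suc n)
    have "summable (\<lambda>k. norm ((q ^ Suc n) $ k))"
    proof (rule summable_comparison_test'[where N = 0])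
      show "summable (\<lambda>k. \<Sum>i\<le>k. norm (q $ i) * norm ((q ^ n) $ (k - i)))"
        using Cauchy_product_sums[of "\<lambda>k. norm (q $ k)" "\<lambda>k. norm ((q ^ n) $ k)"] assms Suc
        by (auto simp: sums_iff)
      show "norm (norm ((q ^ Suc n) $ k)) \<le> (\<Sum>i\<le>k. norm (q $ i) * norm ((q ^ n) $ (k - i)))" for k
        by (auto simp: fps_mult_nth atLeast0AtMost abs_mult intro!: order.trans[OF sum_abs])
    qed
    moreover
    let ?e = "\<lambda>f k. of_real (f $ k) * z ^ k"
    have "(\<lambda>k. \<Sum>i\<le>k. ?e q i * ?e (q ^ n) (k - i)) sums (suminf (?e q) * suminf (?e (q ^ n)))"
      using Suc assms by (intro Cauchy_product_sums abs) auto
    moreover have "(\<Sum>i\<le>k. ?e q i * ?e (q ^ n) (k - i)) = ?e (q ^ Suc n) k" for k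
    proof -
      have "?e q i * ?e (q ^ n) (k - i) = of_real (q $ i * (q ^ n) $ (k - i)) * z ^ k" if "i \<le> k" for i
        using that power_add[of z i "k - i"] by simp
      then have "(\<Sum>i\<le>k. ?e q i * ?e (q ^ n) (k - i)) =
          (\<Sum>i\<le>k. of_real (q $ i * (q ^ n) $ (k - i)) * z ^ k)"
        by (intro sum.cong) auto
      then show ?thesis
        by (simp add: fps_mult_nth atLeast0AtMost sum_distrib_right)
    qed
    moreover have "suminf (?e (q ^ n)) = suminf (?e q) ^ n"
      using Suc by (simp add: sums_iff)
    ultimately show ?case by simp
  qed
  then show ?thesis ..
qed

text \<open>Coefficient \<open>k\<close> of \<open>q ^ Suc n\<close> contains the summand
  \<open>q $ k * (q $ 0) ^ n\<close>, so \<open>q\<close> is summable by comparison. Evaluation at 1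
  shows that its sum is a nonnegative real whose power \<open>Suc n\<close> is 1.\<close>

lemma fps_root_sums_1:
  fixes q :: "real fps"
  assumes nonneg: "\<And>k. q $ k \<ge> 0" and q0: "q $ 0 > 0"
    and sums: "(\<lambda>k. (q ^ Suc n) $ k) sums 1"
  shows "(\<lambda>k. q $ k) sums 1"
proof -
  have pow_nonneg: "(q ^ m) $ k \<ge> 0" for m k
    by (induction m arbitrary: k) (auto simp: fps_mult_nth nonneg intro!: sum_nonneg)
  have le: "q $ k * (q $ 0) ^ n \<le> (q ^ Suc n) $ k" for k
  proof -
    have "q $ k * (q ^ n) $ (k - k) \<le> (\<Sum>i\<in>{0..k}. q $ i * (q ^ n) $ (k - i))"
      by (rule member_le_sum) (auto simp: nonneg pow_nonneg)
    then show ?thesis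
      by (simp add: fps_mult_nth fps_nth_power_0)
  qed
  have "summable (\<lambda>k. q $ k * (q $ 0) ^ n)"
    by (rule summable_comparison_test'[where N = 0, OF sums_summable[OF sums]])
      (use le nonneg q0 in auto)
  then have "summable (\<lambda>k. q $ k * (q $ 0) ^ n / (q $ 0) ^ n)"
    by (rule summable_divide)
  then have q: "summable (\<lambda>k. q $ k)"
    using q0 by simp
  have "(\<lambda>k. of_real ((q ^ Suc n) $ k)) sums (\<Sum>k. complex_of_real (q $ k)) ^ Suc n"
    using fps_power_sums[of q 1 "Suc n"] q nonneg by simp
  moreover have "(\<lambda>k. of_real ((q ^ Suc n) $ k)) sums complex_of_real 1"
    using sums by (simp only: sums_of_real_iff)
  ultimately have "(\<Sum>k. complex_of_real (q $ k)) ^ Suc n = complex_of_real 1"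
    by (rule sums_unique2)
  then have "complex_of_real (suminf (($) q) ^ Suc n) = complex_of_real 1"
    using q by (simp add: suminf_of_real del: power_Suc)
  then have "suminf (($) q) ^ Suc n = 1"
    by (simp only: of_real_eq_iff)
  moreover have "suminf (($) q) \<ge> 0"
    using q nonneg by (rule suminf_nonneg)
  ultimately have "suminf (($) q) = 1"
    using power_eq_1_iff by (metis abs_of_nonneg power_eq_imp_eq_base power_one zero_le_one zero_less_Suc)
  with q show ?thesis
    by (simp add: sums_iff)
qed

section \<open>Lattice distributions and their characteristic functions\<close>

lemma pmf_of_sums:
  fixes f :: "nat \<Rightarrow> real"
  assumes nonneg: "\<And>k. f k \<ge> 0" and "f sums 1"
  obtains p where "\<And>k. pmf p k = f k"
proof -
  have "(\<integral>\<^sup>+x. ennreal (f x) \<partial>count_space UNIV) = 1"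
    using assms sums_unique[OF assms(2)]
    by (simp add: nn_integral_count_space_nat suminf_ennreal_eq)
  then have "pmf (embed_pmf f) k = f k" for k
    using nonneg by (intro pmf_embed_pmf) auto
  then show thesis by (rule that)
qed

lemma pmf_nat_sums_1: "pmf (p :: nat pmf) sums 1"
proof -
  have "integrable (count_space UNIV) (pmf p)"
    by (rule integrable_pmf)
  from sums_integral_count_space_nat[OF this] show ?thesis
    by (simp add: integral_pmf)
qed

text \<open>The characteristic function is the generating series at a point of the unit circle, so
  identities between power series become identities between distributions.\<close>

lemma char_lattice_distr:
  fixes p :: "nat pmf"
  shows "char (distr (measure_pmf p) borel (\<lambda>k. h * real k)) t =
    (\<Sum>k. of_real (pmf p k) * iexp (t * h) ^ k)"
proof -
  have int: "integrable (count_space UNIV) (\<lambda>k. of_real (pmf p k) * iexp (t * h) ^ k)"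
  proof (rule Bochner_Integration.integrable_bound[OF integrable_pmf[of UNIV p]])
    show "AE k in count_space UNIV. norm (of_real (pmf p k) * iexp (t * h) ^ k) \<le> norm (pmf p k)"
      by (simp add: norm_mult norm_power)
  qed simp
  have iexp: "iexp (t * (h * real k)) = iexp (t * h) ^ k" for k
    by (simp add: exp_of_nat_mult[symmetric] algebra_simps)
  have "char (distr (measure_pmf p) borel (\<lambda>k. h * real k)) t =
    (CLINT k|measure_pmf p. iexp (t * h) ^ k)"
    unfolding char_def by (subst integral_distr) (auto simp: iexp[simplified])
  also have "\<dots> = (\<integral>k. of_real (pmf p k) * iexp (t * h) ^ k \<partial>count_space UNIV)"
    unfolding measure_pmf_eq_density by (subst integral_density) (auto simp: scaleR_conv_of_real)
  also have "\<dots> = (\<Sum>k. of_real (pmf p k) * iexp (t * h) ^ k)"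
    by (rule integral_count_space_nat[OF int])
  finally show ?thesis .
qed

section \<open>Convolution powers of real distributions\<close>

lemma real_distribution_convolution:
  assumes "real_distribution M" "real_distribution N"
  shows "real_distribution (M \<star> N)"
proof -
  interpret M: real_distribution M by fact
  interpret N: real_distribution N by fact
  interpret pair_prob_space M N ..
  show ?thesis
    unfolding convolution_def by (rule real_distribution_distr) simp
qed

lemma char_convolution:
  assumes "real_distribution M" "real_distribution N"
  shows "char (M \<star> N) t = char M t * char N t"
proof -
  interpret M: real_distribution M by fact
  interpret N: real_distribution N by fact
  interpret pair_prob_space M N ..
  have int: "integrable (M \<Otimes>\<^sub>M N) (\<lambda>(x, y). iexp (t * x) * iexp (t * y))"
    by (intro integrable_const_bound[of _ 1]) (auto simp: norm_mult)
  have "char (M \<star> N) t = (CLINT z|M \<Otimes>\<^sub>M N. (case z of (x, y) \<Rightarrow> iexp (t * x) * iexp (t * y)))"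
    unfolding char_def convolution_def
    by (subst integral_distr)
      (auto intro!: Bochner_Integration.integral_cong simp: exp_add[symmetric] algebra_simps)
  also have "\<dots> = (CLINT x|M. CLINT y|N. iexp (t * x) * iexp (t * y))"
    using integral_fst'[OF int] by simp
  also have "\<dots> = char M t * char N t"
    by (simp add: char_def)
  finally show ?thesis .
qed

lemma real_distribution_convolution_power:
  assumes "real_distribution N"
  shows "real_distribution (convolution_power N n)"
proof (induction n)
  case 0
  have "prob_space (return borel (0 :: real))"
    by (rule prob_space_return) simp
  then show ?case
    by (simp add: real_distribution_def real_distribution_axioms_def)
qed (simp add: assms real_distribution_convolution)

lemma char_convolution_power:
  assumes "real_distribution N"
  shows "char (convolution_power N n) t = char N t ^ n"
proof (induction n)
  case 0
  show ?case
    by (simp add: char_def integral_return)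
next
  case (Suc n)
  then show ?case
    by (simp add: char_convolution assms real_distribution_convolution_power)
qed

text \<open>If \<open>x \<ge> 0\<close>, then \<open>y + x < 0\<close> forces \<open>y < 0\<close>.
  So for almost every \<open>x\<close> the inner measure is at most the mass of the previous power
  on \<open>{..<0}\<close>.\<close>

lemma null_negative_convolution_power:
  assumes N: "real_distribution N" and null: "emeasure N {..<0} = 0"
  shows "emeasure (convolution_power N n) {..<0} = 0"
proof (induction n)
  case 0
  show ?case by (simp add: emeasure_return)
next
  case (Suc n)
  let ?C = "convolution_power N n"
  interpret N: real_distribution N by fact
  interpret C: real_distribution ?C
    by (rule real_distribution_convolution_power[OF N])
  have "AE x in N. x \<notin> {..<0}"
    using null by (intro AE_not_in) auto
  then have "AE x in N. emeasure ?C {y. y + x \<in> {..<0}} = 0"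
  proof eventually_elim
    case (elim x)
    then have "{y. y + x \<in> {..<0}} \<subseteq> {..<0}" by auto
    then show ?case
      using Suc by (metis emeasure_mono le_zero_eq C.events_eq_borel lessThan_borel)
  qed
  then have "(\<integral>\<^sup>+x. emeasure ?C {y. y + x \<in> {..<0}} \<partial>N) = (\<integral>\<^sup>+x. 0 \<partial>N)"
    by (rule nn_integral_cong_AE)
  then show ?case
    using convolution_emeasure[of "{..<0}" N ?C] N.finite_measure_axioms C.finite_measure_axioms
    by simp
qed

text \<open>Adding nonnegative independent summands only moves mass to the right: for
  \<open>x > a\<close>, the event \<open>y + x \<le> a\<close> lies in the null set
  \<open>{..<0}\<close>. This is the source of tightness for the roots.\<close>

lemma cdf_convolution_power_le:
  assumes N: "real_distribution N" and null: "emeasure N {..<0} = 0"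
  shows "cdf (convolution_power N (Suc n)) a \<le> cdf N a"
proof -
  let ?C = "convolution_power N n"
  interpret N: real_distribution N by fact
  interpret C: real_distribution ?C
    by (rule real_distribution_convolution_power[OF N])
  interpret D: real_distribution "convolution_power N (Suc n)"
    by (rule real_distribution_convolution_power[OF N])
  have "emeasure ?C {y. y + x \<in> {..a}} \<le> indicator {..a} x" for x
  proof (cases "x \<le> a")
    case True
    then show ?thesis by (simp add: C.emeasure_le_1)
  next
    case False
    then have "{y. y + x \<in> {..a}} \<subseteq> {..<0}" by auto
    then have "emeasure ?C {y. y + x \<in> {..a}} \<le> emeasure ?C {..<0}"
      by (rule emeasure_mono) simp
    then show ?thesis
      using null_negative_convolution_power[OF assms] by simp
  qed
  then have "(\<integral>\<^sup>+x. emeasure ?C {y. y + x \<in> {..a}} \<partial>N) \<le> (\<integral>\<^sup>+x. indicator {..a} x \<partial>N)"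
    by (intro nn_integral_mono)
  then have "emeasure (convolution_power N (Suc n)) {..a} \<le> emeasure N {..a}"
    using convolution_emeasure[of "{..a}" N ?C] N.finite_measure_axioms C.finite_measure_axioms
    by simp
  then show ?thesis
    by (simp add: cdf_def N.emeasure_eq_measure D.emeasure_eq_measure
        del: convolution_power.simps)
qed

section \<open>Convolution roots on a lattice and in the weak limit\<close>

text \<open>The coefficients of the power series root \<open>Q\<close> are nonnegative with sum 1,
  hence a pmf. Evaluating \<open>Q ^ Suc n = P\<close> on the unit circle equates the characteristic
  functions, whatever the mesh \<open>h\<close>.\<close>

lemma log_convex_pmf_convolution_root:
  fixes p :: "nat pmf"
  assumes pos: "\<And>k. pmf p k > 0" and ratio: "incseq (\<lambda>k. pmf p (Suc k) / pmf p k)"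
  obtains q :: "nat pmf" where
    "\<And>h. convolution_power (distr (measure_pmf q) borel (\<lambda>k. h * real k)) (Suc n) =
      distr (measure_pmf p) borel (\<lambda>k. h * real k)"
proof -
  define P where "P = Abs_fps (pmf p)"
  have "inverse P $ Suc k \<le> 0" for k
    by (rule fps_inverse_nonpos_of_log_convex) (use assms in \<open>simp_all add: P_def\<close>)
  then obtain Q where Q: "Q ^ Suc n = P" "\<And>k. Q $ k \<ge> 0" "Q $ 0 > 0"
    using fps_nonneg_root[of P n] pos by (auto simp: P_def)
  have "(\<lambda>k. (Q ^ Suc n) $ k) sums 1"
    unfolding Q(1) using pmf_nat_sums_1[of p] by (simp add: P_def)
  then have Q_sums: "(\<lambda>k. Q $ k) sums 1"
    by (intro fps_root_sums_1 Q)
  then obtain q where q: "\<And>k. pmf q k = Q $ k"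
    using pmf_of_sums[of "\<lambda>k. Q $ k"] Q(2) by blast
  have "convolution_power (distr (measure_pmf q) borel (\<lambda>k. h * real k)) (Suc n) =
      distr (measure_pmf p) borel (\<lambda>k. h * real k)" (is "convolution_power ?q _ = ?p") for h
  proof (rule Levy_uniqueness)
    have rd: "real_distribution (distr (measure_pmf u) borel (\<lambda>k. h * real k))" for u :: "nat pmf"
      by (rule prob_space.real_distribution_distr[OF measure_pmf.prob_space_axioms]) simp
    then show "real_distribution ?p" "real_distribution (convolution_power ?q (Suc n))"
      by (simp_all add: real_distribution_convolution_power del: convolution_power.simps)
    show "char (convolution_power ?q (Suc n)) = char ?p"
    proof
      fix t
      have "(\<lambda>k. of_real ((Q ^ Suc n) $ k) * iexp (t * h) ^ k) sums
          (\<Sum>k. of_real (Q $ k) * iexp (t * h) ^ k) ^ Suc n"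
        by (rule fps_power_sums) (use Q_sums Q(2) in \<open>auto simp: sums_iff\<close>)
      then show "char (convolution_power ?q (Suc n)) t = char ?p t"
        unfolding char_convolution_power[OF rd] char_lattice_distr q Q(1)
        by (simp add: P_def sums_iff del: power_Suc)
    qed
  qed
  then show thesis by (rule that)
qed

text \<open>Tightness gives a subsequence of the roots with a weak limit \<open>N'\<close>. Along it
  the characteristic functions of the powers tend both to \<open>char M t\<close> and to
  \<open>char N' t ^ n\<close>.\<close>

lemma convolution_root_weak_limit:
  assumes M: "real_distribution M" and tight: "tight N"
    and conv: "weak_conv_m (\<lambda>m. convolution_power (N m) n) M"
  obtains N' where "real_distribution N'" "M = convolution_power N' n"
proof -
  have N: "real_distribution (N m)" for m
    using tight by (simp add: tight_def)
  obtain s N' where s: "strict_mono (s :: nat \<Rightarrow> nat)" and N': "real_distribution N'"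
    and lim: "weak_conv_m (N \<circ> s) N'"
    using tight_imp_convergent_subsubsequence[OF tight strict_mono_id] by (auto simp: comp_def)
  have "M = convolution_power N' n"
  proof (rule Levy_uniqueness[OF M real_distribution_convolution_power[OF N']], rule ext)
    fix t
    have "(\<lambda>m. char (convolution_power (N m) n) t) \<longlonglongrightarrow> char M t"
      by (rule levy_continuity1[OF _ M conv]) (rule real_distribution_convolution_power[OF N])
    then have "(\<lambda>m. char (N (s m)) t ^ n) \<longlonglongrightarrow> char M t"
      using LIMSEQ_subseq_LIMSEQ[OF _ s] by (fastforce simp: char_convolution_power N comp_def)
    moreover have "(\<lambda>m. char ((N \<circ> s) m) t ^ n) \<longlonglongrightarrow> char N' t ^ n"
      by (intro tendsto_power levy_continuity1[OF _ N' lim]) (simp add: N)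
    ultimately show "char M t = char (convolution_power N' n) t"
      unfolding char_convolution_power[OF N'] comp_def by (rule LIMSEQ_unique)
  qed
  with N' show thesis by (rule that)
qed

section \<open>Distribution functions with log-convex density on the positive half-line\<close>

text \<open>Log-convexity is stated without division: it says that \<open>f (x + h) / f x\<close>
  increases with \<open>x\<close>. The density is constrained only for positive arguments, so it may
  be unbounded near 0; continuity of \<open>F\<close> excludes an atom there.\<close>

locale log_convex_density =
  fixes F f :: "real \<Rightarrow> real"
  assumes zero: "\<And>x. x \<le> 0 \<Longrightarrow> F x = 0"
    and cont: "\<And>x. isCont F x"
    and deriv: "\<And>x. x > 0 \<Longrightarrow> (F has_real_derivative f x) (at x)"
    and pos: "\<And>x. x > 0 \<Longrightarrow> f x > 0"
    and log_convex: "\<And>x y h. 0 < x \<Longrightarrow> x \<le> y \<Longrightarrow> 0 \<le> h \<Longrightarrow> f (x + h) * f y \<le> f x * f (y + h)"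
    and lim: "(F \<longlongrightarrow> 1) at_top"
begin

lemma strict_increasing:
  assumes "0 \<le> x" "x < y"
  shows "F x < F y"
proof (rule DERIV_pos_imp_increasing_open[OF \<open>x < y\<close>])
  show "\<exists>z. (F has_real_derivative z) (at u) \<and> 0 < z" if "x < u" for u
    using deriv[of u] pos[of u] that assms by (intro exI[of _ "f u"]) simp
  show "continuous_on {x..y} F"
    by (intro continuous_at_imp_continuous_on ballI cont)
qed

lemma increasing: "x \<le> y \<Longrightarrow> F x \<le> F y"
proof -
  assume xy: "x \<le> y"
  have nonneg: "0 \<le> F y"
    using strict_increasing[of 0 y] zero[of 0] zero[of y] by (cases "0 < y") auto
  consider "x \<le> 0" | "x = y" | "0 < x" "x < y" using xy by linarith
  then show "F x \<le> F y"
    by cases (use nonneg zero[of x] strict_increasing[of x y] in auto)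
qed

lemma real_distribution: "real_distribution (interval_measure F)"
  and cdf: "cdf (interval_measure F) = F"
proof -
  have right: "continuous (at_right a) F" for a
    using cont by (rule continuous_at_imp_continuous_at_within)
  have bot: "(F \<longlongrightarrow> 0) at_bot"
    by (rule tendsto_eventually) (use zero in \<open>auto simp: eventually_at_bot_linorder\<close>)
  show "real_distribution (interval_measure F)"
    by (intro real_distribution_interval_measure increasing right bot lim)
  show "cdf (interval_measure F) = F"
    by (intro cdf_interval_measure increasing right bot)
qed

text \<open>The mass of \<open>{h * real k<..h * real (Suc k)}\<close>; the approximating lattice
  distribution places it at the left endpoint.\<close>

definition cell :: "real \<Rightarrow> nat \<Rightarrow> real" where
  "cell h k = F (h * real (Suc k)) - F (h * real k)"

lemma cell_pos: "h > 0 \<Longrightarrow> cell h k > 0"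
  unfolding cell_def using strict_increasing[of "h * real k" "h * real (Suc k)"] by simp

lemma sum_cell: "(\<Sum>k<n. cell h k) = F (h * real n)"
  using sum_lessThan_telescope[of "\<lambda>k. F (h * real k)" n] by (simp add: cell_def zero)

lemma cell_sums: "h > 0 \<Longrightarrow> cell h sums 1"
  unfolding sums_def sum_cell
  by (rule filterlim_compose[OF lim])
    (rule filterlim_tendsto_pos_mult_at_top[OF tendsto_const _ filterlim_real_sequentially])

text \<open>Cauchy's mean value theorem for \<open>F\<close> and its shift by \<open>h\<close> on
  one cell: the shift turns increments over this cell into increments over the next, and both
  derivatives are taken at the same point \<open>c\<close>.\<close>

lemma cell_ratio:
  assumes "h > 0"
  obtains c where "h * real k < c" "c < h * real (Suc k)" "cell h (Suc k) / cell h k = f (c + h) / f c"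
proof -
  have "\<exists>c. h * real k < c \<and> c < h * real (Suc k) \<and>
    (F (h * real (Suc k) + h) - F (h * real k + h)) * f c = (F (h * real (Suc k)) - F (h * real k)) * f (c + h)"
  proof (rule GMVT')
    fix z
    show "isCont F z" by (rule cont)
    show "isCont (\<lambda>x. F (x + h)) z"
      by (rule isCont_o2[where g = F]) (simp_all add: cont)
    assume "h * real k < z"
    moreover have "0 \<le> h * real k" using assms by simp
    ultimately have z: "z > 0" by linarith
    then show "(F has_real_derivative f z) (at z)" by (rule deriv)
    have "(F has_real_derivative f (z + h)) (at (z + h))"
      using z assms by (intro deriv) simp
    then show "((\<lambda>x. F (x + h)) has_real_derivative f (z + h)) (at z)"
      by (simp add: DERIV_shift)
  qed (use assms in simp)
  moreover have "h * real k + h = h * real (Suc k)" for k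
    by (simp add: algebra_simps)
  ultimately obtain c where c: "h * real k < c" "c < h * real (Suc k)"
      "cell h (Suc k) * f c = cell h k * f (c + h)"
    unfolding cell_def by metis
  have "0 \<le> h * real k" using assms by simp
  with c(1) have "c > 0" by linarith
  then have "cell h (Suc k) / cell h k = f (c + h) / f c"
    using c(3) cell_pos[OF assms, of k] pos[of c] by (simp add: frac_eq_eq mult.commute)
  with c(1,2) show thesis by (rule that)
qed

text \<open>The intermediate points \<open>c\<close> and \<open>d\<close> of consecutive ratios are
  separated by the grid point \<open>h * real (Suc k)\<close>, so log-convexity compares the two
  quotients.\<close>

lemma cell_ratio_incseq:
  assumes "h > 0"
  shows "incseq (\<lambda>k. cell h (Suc k) / cell h k)"
proof (rule incseq_SucI)
  fix k
  obtain c where c: "h * real k < c" "c < h * real (Suc k)" "cell h (Suc k) / cell h k = f (c + h) / f c"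
    using cell_ratio[OF assms] .
  obtain d where d: "h * real (Suc k) < d" "cell h (Suc (Suc k)) / cell h (Suc k) = f (d + h) / f d"
    using cell_ratio[OF assms, of "Suc k"] by blast
  have "0 \<le> h * real k" using assms by simp
  with c(1) have "c > 0" by linarith
  moreover have "c < d" using c d by simp
  ultimately have "f (c + h) / f c \<le> f (d + h) / f d"
    using log_convex[of c d h] pos[of c] pos[of d] assms by (simp add: field_simps)
  then show "cell h (Suc k) / cell h k \<le> cell h (Suc (Suc k)) / cell h (Suc k)"
    unfolding c(3) d(2) .
qed

text \<open>The atoms up to \<open>x\<close> have indices up to the floor of \<open>x / h\<close>,
  and their masses telescope. As mass sits at left endpoints, the value is \<open>F\<close> at the
  first grid point beyond \<open>x\<close>, hence at least \<open>F x\<close>.\<close>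

lemma cdf_lattice:
  assumes h: "h > 0" and p: "\<And>k. pmf p k = cell h k" and x: "x \<ge> 0"
  shows "cdf (distr (measure_pmf p) borel (\<lambda>k. h * real k)) x = F (h * real (Suc (nat \<lfloor>x / h\<rfloor>)))"
proof -
  have "{k. h * real k \<le> x} = {..nat \<lfloor>x / h\<rfloor>}"
    using h x by (auto simp: le_nat_iff le_floor_iff field_simps)
  then have "(\<lambda>k. h * real k) -` {..x} = {..<Suc (nat \<lfloor>x / h\<rfloor>)}"
    by (auto simp: vimage_def lessThan_Suc_atMost)
  then show ?thesis
    by (simp add: cdf_def measure_distr measure_measure_pmf_finite p sum_cell del: sum.lessThan_Suc of_nat_Suc)
qed

lemma cdf_lattice_neg:
  assumes "h > 0" "x < 0"
  shows "cdf (distr (measure_pmf p) borel (\<lambda>k. h * real k)) x = 0"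
proof -
  have "\<not> h * real k \<le> x" for k
    using assms mult_nonneg_nonneg[of h "real k"] by linarith
  then have "(\<lambda>k. h * real k) -` {..x} = {}"
    by auto
  then show ?thesis
    by (simp add: cdf_def measure_distr)
qed

theorem infinitely_divisible: "infinitely_divisible_cdf F"
proof -
  let ?M = "interval_measure F"
  define h where "h m = 1 / real (Suc m)" for m
  have h: "h m > 0" for m by (simp add: h_def)
  have h_lim: "h \<longlonglongrightarrow> 0"
    unfolding h_def using LIMSEQ_inverse_real_of_nat by (simp add: inverse_eq_divide)
  have "\<exists>p. \<forall>k. pmf p k = cell (h m) k" for m
    using pmf_of_sums[OF less_imp_le[OF cell_pos[OF h]] cell_sums[OF h]] by metis
  then obtain p where p: "\<And>m k. pmf (p m) k = cell (h m) k" by metis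
  define L where "L q m = distr (measure_pmf q) borel (\<lambda>k :: nat. h m * real k)" for q m
  have L: "real_distribution (L q m)" for q m
    unfolding L_def by (rule prob_space.real_distribution_distr[OF measure_pmf.prob_space_axioms]) simp
  have cdf_L: "cdf (L (p m) m) x = F (h m * real (Suc (nat \<lfloor>x / h m\<rfloor>)))" if "x \<ge> 0" for m x
    unfolding L_def using h p that by (rule cdf_lattice)
  \<comment> \<open>Both bounds give the weak convergence; the lower one alone serves for
    tightness.\<close>
  have grid: "x \<le> h m * real (Suc (nat \<lfloor>x / h m\<rfloor>))" "h m * real (Suc (nat \<lfloor>x / h m\<rfloor>)) \<le> x + h m"
    if "x \<ge> 0" for m x
  proof -
    have "real (nat \<lfloor>x / h m\<rfloor>) = of_int \<lfloor>x / h m\<rfloor>"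
      using that h[of m] by simp
    then have "x / h m \<le> real (Suc (nat \<lfloor>x / h m\<rfloor>))" "real (Suc (nat \<lfloor>x / h m\<rfloor>)) \<le> x / h m + 1"
      by linarith+
    then show "x \<le> h m * real (Suc (nat \<lfloor>x / h m\<rfloor>))" "h m * real (Suc (nat \<lfloor>x / h m\<rfloor>)) \<le> x + h m"
      using h[of m] by (simp_all add: field_simps)
  qed
  have weak: "weak_conv_m (\<lambda>m. L (p m) m) ?M"
    unfolding weak_conv_m_def weak_conv_def cdf
  proof safe
    fix x
    show "(\<lambda>m. cdf (L (p m) m) x) \<longlonglongrightarrow> F x"
    proof (cases "x \<ge> 0")
      case True
      have "(\<lambda>m. h m * real (Suc (nat \<lfloor>x / h m\<rfloor>))) \<longlonglongrightarrow> x"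
      proof (rule tendsto_sandwich)
        show "(\<lambda>m. x) \<longlonglongrightarrow> x" by simp
        show "(\<lambda>m. x + h m) \<longlonglongrightarrow> x"
          using tendsto_add[OF tendsto_const h_lim] by simp
      qed (intro always_eventually allI grid True)+
      then have "(\<lambda>m. F (h m * real (Suc (nat \<lfloor>x / h m\<rfloor>)))) \<longlonglongrightarrow> F x"
        by (rule isCont_tendsto_compose[OF cont])
      then show ?thesis
        by (simp add: cdf_L[OF True])
    next
      case False
      then show ?thesis
        using cdf_lattice_neg[OF h] zero by (simp add: L_def)
    qed
  qed
  have "\<exists>N. real_distribution N \<and> ?M = convolution_power N (Suc n)" for n
  proof -
    have "\<exists>q. \<forall>h. convolution_power (distr (measure_pmf q) borel (\<lambda>k. h * real k)) (Suc n) =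
        distr (measure_pmf (p m)) borel (\<lambda>k. h * real k)" for m
      using log_convex_pmf_convolution_root[of "p m" n] cell_pos[OF h] cell_ratio_incseq[OF h]
      unfolding p by metis
    then obtain q where q: "\<And>m. convolution_power (L (q m) m) (Suc n) = L (p m) m"
      unfolding L_def by metis
    have "tight (\<lambda>m. L (q m) m)"
      unfolding tight_def
    proof (intro conjI allI impI L)
      fix \<epsilon> :: real assume "\<epsilon> > 0"
      then have "\<forall>\<^sub>F x in at_top. F x > 1 - \<epsilon>"
        using order_tendstoD(1)[OF lim, of "1 - \<epsilon>"] by simp
      then obtain b where b: "\<And>x. x \<ge> b \<Longrightarrow> F x > 1 - \<epsilon>"
        by (auto simp: eventually_at_top_linorder)
      \<comment> \<open>The maximum ensures \<open>a \<ge> 0\<close>, as the formula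
        \<open>cdf_L\<close> requires.\<close>
      define a where "a = max b 0"
      \<comment> \<open>The roots have no mass below 0, so the negative left end \<open>-1\<close>
        loses nothing, and the mass of the interval is the cdf at \<open>a\<close>.\<close>
      have "1 - \<epsilon> < measure (L (q m) m) {-1<..a}" for m
      proof -
        interpret N: real_distribution "L (q m) m" by (rule L)
        have "(\<lambda>k. h m * real k) -` {..<0} = {}"
          using h[of m] by (auto simp: mult_less_0_iff)
        then have null: "emeasure (L (q m) m) {..<0} = 0"
          by (simp add: L_def emeasure_distr)
        have a: "a \<ge> 0" by (simp add: a_def)
        have "1 - \<epsilon> < F a" using b by (simp add: a_def)
        also have "\<dots> \<le> cdf (L (p m) m) a"
          unfolding cdf_L[OF a] by (intro increasing grid a)
        also have "\<dots> \<le> cdf (L (q m) m) a"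
          using cdf_convolution_power_le[OF L null, of n a] by (simp only: q)
        also have "\<dots> = measure (L (q m) m) {-1<..a}"
          using N.cdf_diff_eq[of "-1" a] cdf_lattice_neg[OF h[of m], of "-1" "q m"]
          by (simp add: L_def a_def)
        finally show ?thesis .
      qed
      moreover have "-1 < a" by (simp add: a_def)
      ultimately show "\<exists>a b. a < b \<and> (\<forall>m. 1 - \<epsilon> < measure (L (q m) m) {a<..b})" by blast
    qed
    then obtain N where "real_distribution N" "?M = convolution_power N (Suc n)"
      using convolution_root_weak_limit[OF real_distribution, of "\<lambda>m. L (q m) m" "Suc n"] weak
      unfolding q by blast
    then show ?thesis by blast
  qed
  then have "\<exists>N. real_distribution N \<and> ?M = convolution_power N n" if "n \<ge> 1" for n
    using that by (cases n) auto
  then show ?thesis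
    unfolding infinitely_divisible_cdf_def using real_distribution cdf by blast
qed

end

section \<open>The power of the log-logistic distribution function\<close>

text \<open>Concavity of the power function: its derivative has the nonpositive exponent
  \<open>a - 1\<close> and is therefore decreasing.\<close>

lemma powr_increment_antimono:
  fixes x y h a :: real
  assumes "0 < x" "x \<le> y" "0 \<le> h" "0 \<le> a" "a \<le> 1"
  shows "(y + h) powr a - y powr a \<le> (x + h) powr a - x powr a"
proof (rule DERIV_nonpos_imp_nonincreasing[OF \<open>x \<le> y\<close>])
  fix u assume "x \<le> u"
  with assms have u: "u > 0" by simp
  have "((\<lambda>v. (v + h) powr a - v powr a) has_real_derivative
      a * (u + h) powr (a - 1) - a * u powr (a - 1)) (at u)"
    using u assms by (auto intro!: derivative_eq_intros)
  moreover have "(u + h) powr (a - 1) \<le> u powr (a - 1)"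
    using u assms by (intro powr_mono2') auto
  then have "a * (u + h) powr (a - 1) - a * u powr (a - 1) \<le> 0"
    using assms by (simp add: mult_left_mono)
  ultimately show "\<exists>d. ((\<lambda>v. (v + h) powr a - v powr a) has_real_derivative d) (at u) \<and> d \<le> 0"
    by blast
qed

text \<open>Up to a constant factor \<open>f\<close> is the density. The inequality is proved for
  the bases \<open>x\<close> and \<open>b x\<close> separately, in the opposite direction; the
  exponents \<open>r * \<gamma> - 1\<close> and \<open>- r - 1\<close> are nonpositive and reverse
  it.\<close>

lemma loglogistic_log_convex:
  fixes x y h r \<gamma> \<Lambda> :: real
  assumes "r \<in> {0<..1}" "\<gamma> \<in> {0<..1}" "\<Lambda> > 0" and xy: "0 < x" "x \<le> y" "0 \<le> h"
  defines "f \<equiv> \<lambda>x. x powr (r * \<gamma> - 1) * (1 + \<Lambda> * x powr \<gamma>) powr (- r - 1)"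
  shows "f (x + h) * f y \<le> f x * f (y + h)"
proof -
  define b where "b x = 1 + \<Lambda> * x powr \<gamma>" for x
  have b: "b u > 0" for u
    using assms by (simp add: b_def add_pos_nonneg)
  have prod: "x * (y + h) \<le> (x + h) * y"
    using mult_left_mono[OF xy(2,3)] by (simp add: algebra_simps)
  have powr_prod: "x powr \<gamma> * (y + h) powr \<gamma> \<le> (x + h) powr \<gamma> * y powr \<gamma>"
    using powr_mono2[OF _ _ prod, of \<gamma>] assms by (simp add: powr_mult)
  have powr_sum: "x powr \<gamma> + (y + h) powr \<gamma> \<le> (x + h) powr \<gamma> + y powr \<gamma>"
    using powr_increment_antimono[OF xy, of \<gamma>] assms by simp
  \<comment> \<open>These are the expanded products of the values of \<open>b\<close> without the
    constant 1. Concavity handles the linear part, monotonicity the quadratic part.\<close>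
  have "\<Lambda> * (x powr \<gamma> + (y + h) powr \<gamma>) + \<Lambda>\<^sup>2 * (x powr \<gamma> * (y + h) powr \<gamma>)
      \<le> \<Lambda> * ((x + h) powr \<gamma> + y powr \<gamma>) + \<Lambda>\<^sup>2 * ((x + h) powr \<gamma> * y powr \<gamma>)"
    using assms by (intro add_mono mult_left_mono powr_prod powr_sum) auto
  then have "b x * b (y + h) \<le> b (x + h) * b y"
    by (simp add: b_def algebra_simps power2_eq_square)
  then have 1: "(b (x + h) * b y) powr (- r - 1) \<le> (b x * b (y + h)) powr (- r - 1)"
    using assms b by (intro powr_mono2') auto
  have "r * \<gamma> \<le> 1"
    using assms by (auto intro: mult_le_one)
  then have 2: "((x + h) * y) powr (r * \<gamma> - 1) \<le> (x * (y + h)) powr (r * \<gamma> - 1)"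
    using xy prod by (intro powr_mono2') auto
  have "((x + h) * y) powr (r * \<gamma> - 1) * (b (x + h) * b y) powr (- r - 1)
      \<le> (x * (y + h)) powr (r * \<gamma> - 1) * (b x * b (y + h)) powr (- r - 1)"
    using 1 2 by (intro mult_mono) auto
  then show ?thesis
    using xy b less_imp_le[OF b] by (simp add: f_def b_def[symmetric] powr_mult mult_ac)
qed

theorem corollary2:
  fixes r \<gamma> \<Lambda> :: real
  assumes "r \<in> {0<..1}" and "\<gamma> \<in> {0<..1}" and "\<Lambda> > 0"
  shows "infinitely_divisible_cdf
    (\<lambda>x. if x \<ge> 0 then (\<Lambda> * x powr \<gamma> / (1 + \<Lambda> * x powr \<gamma>)) powr r else 0)"
    (is "infinitely_divisible_cdf ?F")
proof -
  define f where "f x = x powr (r * \<gamma> - 1) * (1 + \<Lambda> * x powr \<gamma>) powr (- r - 1)" for x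
  define C where "C = r * \<gamma> * \<Lambda> powr r"
  have C: "C > 0" using assms by (simp add: C_def)
  have b: "1 + \<Lambda> * x powr \<gamma> > 0" for x
    using assms by (simp add: add_pos_nonneg)
  \<comment> \<open>Since \<open>0 powr \<gamma> = 0\<close>, truncating the argument at 0 removes
    the case distinction and makes continuity at 0 compositional.\<close>
  have F: "?F = (\<lambda>x. (\<Lambda> * max 0 x powr \<gamma> / (1 + \<Lambda> * max 0 x powr \<gamma>)) powr r)"
    using assms by (auto simp: max_def)
  interpret log_convex_density ?F "\<lambda>x. C * f x"
  proof
    show "isCont ?F x" for x
    proof -
      have "continuous_on UNIV (\<lambda>x. max 0 x powr \<gamma>)"
        by (rule continuous_on_powr') (use assms in \<open>auto intro!: continuous_intros\<close>)
      then have "continuous_on UNIV (\<lambda>x. \<Lambda> * max 0 x powr \<gamma> / (1 + \<Lambda> * max 0 x powr \<gamma>))"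
        using b by (intro continuous_on_divide continuous_on_add continuous_on_mult continuous_on_const)
          (auto simp: less_imp_neq[symmetric])
      then have "continuous_on UNIV (\<lambda>x. (\<Lambda> * max 0 x powr \<gamma> / (1 + \<Lambda> * max 0 x powr \<gamma>)) powr r)"
        by (rule continuous_on_powr')
          (use assms b in \<open>auto intro!: divide_nonneg_pos continuous_on_const\<close>)
      then show ?thesis
        unfolding F by (simp add: continuous_on_eq_continuous_at)
    qed
    show "(?F has_real_derivative C * f x) (at x)" if x: "x > 0" for x
    proof -
      let ?u = "\<lambda>x. \<Lambda> * x powr \<gamma>"
      have u: "?u x > 0" using assms x by simp
      have "((\<lambda>x. (?u x / (1 + ?u x)) powr r) has_real_derivative
          r * (?u x / (1 + ?u x)) powr (r - 1) *
          ((\<Lambda> * (\<gamma> * x powr (\<gamma> - 1)) * (1 + ?u x) - ?u x * (\<Lambda> * (\<gamma> * x powr (\<gamma> - 1)))) / (1 + ?u x)\<^sup>2)) (at x)"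
        using x u b[of x] by (auto intro!: derivative_eq_intros simp: power2_eq_square)
      \<comment> \<open>In the quotient rule the terms \<open>?u' * ?u\<close> cancel. The factors
        are grouped by base, and the next steps add the exponents for each base.\<close>
      also have "r * (?u x / (1 + ?u x)) powr (r - 1) *
          ((\<Lambda> * (\<gamma> * x powr (\<gamma> - 1)) * (1 + ?u x) - ?u x * (\<Lambda> * (\<gamma> * x powr (\<gamma> - 1)))) / (1 + ?u x)\<^sup>2)
          = r * \<gamma> * (\<Lambda> powr (r - 1) * \<Lambda>) * (x powr (\<gamma> * (r - 1)) * x powr (\<gamma> - 1)) * ((1 + ?u x) powr (1 - r) / (1 + ?u x)\<^sup>2)"
      proof -
        have "(?u x / (1 + ?u x)) powr (r - 1) = \<Lambda> powr (r - 1) * x powr (\<gamma> * (r - 1)) * (1 + ?u x) powr (1 - r)"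
          using assms x u b[of x] by (simp add: powr_divide powr_mult powr_powr powr_minus_divide[of _ "r - 1", simplified])
        then show ?thesis by (simp add: algebra_simps)
      qed
      also have "\<Lambda> powr (r - 1) * \<Lambda> = \<Lambda> powr r"
        using assms by (simp add: powr_mult_base mult.commute)
      also have "x powr (\<gamma> * (r - 1)) * x powr (\<gamma> - 1) = x powr (r * \<gamma> - 1)"
        by (simp add: powr_add[symmetric] algebra_simps)
      also have "(1 + ?u x) powr (1 - r) / (1 + ?u x)\<^sup>2 = (1 + ?u x) powr (- r - 1)"
        using b[of x] by (simp add: minus_diff_commute powr_numeral[symmetric] powr_diff[symmetric] del: powr_numeral)
      finally have "((\<lambda>x. (?u x / (1 + ?u x)) powr r) has_real_derivative C * f x) (at x)"
        by (simp add: C_def f_def mult_ac)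
      \<comment> \<open>On the open half-line \<open>{0<..}\<close> the closed form agrees with
        \<open>?F\<close>, so the derivative carries over.\<close>
      then show ?thesis
        by (rule has_field_derivative_transform_within_open[where S = "{0<..}"]) (use x in auto)
    qed
    show "C * f x > 0" if "x > 0" for x
      using that C b[of x] by (simp add: f_def)
    show "C * f (x + h) * (C * f y) \<le> C * f x * (C * f (y + h))" if "0 < x" "x \<le> y" "0 \<le> h" for x y h
      using mult_left_mono[OF loglogistic_log_convex[OF assms that], of "C * C"]
      by (simp add: f_def mult_ac)
    \<comment> \<open>Numerator and denominator are divided by
      \<open>\<Lambda> * x powr \<gamma>\<close>, which leaves a single vanishing term.\<close>
    have "((\<lambda>x. 1 / (1 + x powr (- \<gamma>) / \<Lambda>)) \<longlongrightarrow> 1 / (1 + 0 / \<Lambda>)) at_top"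
      using assms by (intro tendsto_intros tendsto_neg_powr filterlim_ident) auto
    then have "((\<lambda>x. (1 / (1 + x powr (- \<gamma>) / \<Lambda>)) powr r) \<longlongrightarrow> 1 powr r) at_top"
      by (intro tendsto_powr tendsto_const) auto
    moreover have "\<forall>\<^sub>F x in at_top. (1 / (1 + x powr (- \<gamma>) / \<Lambda>)) powr r = ?F x"
      using eventually_gt_at_top[of 0]
    proof eventually_elim
      case (elim x)
      then have "1 / (1 + x powr (- \<gamma>) / \<Lambda>) = \<Lambda> * x powr \<gamma> / (1 + \<Lambda> * x powr \<gamma>)"
        using assms b[of x] by (simp add: powr_minus field_simps)
      with elim show ?case by simp
    qed
    ultimately show "(?F \<longlongrightarrow> 1) at_top"
      using tendsto_cong by force
  qed (use assms in auto)
  show ?thesis by (rule infinitely_divisible)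
qed

end
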